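(* Let $E_0,E_1,E_2$ be infinite dimensional Banach spaces, $\mathcal I\subset L(E_0,E_1)$ a normed ideal of operators, $C\subset\mathcal I$ and $D\subset E_0$ nonempty closed convex subsets, $A\in C$, $T\in L(E_0,E_2)$ and $b\in E_1$. Let $f:\mathbb R_{\ge0}^3\to\mathbb R_{\ge0}$ be continuous, increasing (in each variable) and coercive. Suppose that $T$ is bounded below and that one of the following holds: (1) $C$ is compact (in the norm of $\mathcal I$), and $D=E_0$ with $E_0$ reflexive; (2) $C=\mathcal I$ is a reflexive Banach space (with its norm $\|\cdot\|_{\mathcal I}$) and $D$ is (norm) compact; (3) $C=\mathcal I=L(E_0,E_1)$ with $E_1$ reflexive, and $D$ is (norm) compact. Then the problem $$\min_{X\in C,\ x\in D}\ f\big(\|Tx\|_{E_2},\ \|A-X\|_{\mathcal I},\ \|Xx-b\|_{E_1}\big)$$ admits a solution, i.e. the minimum is attained.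
   Context: $L(E_0,E_1)$ denotes the bounded linear operators. A normed ideal of operators is a class $\mathcal I$ of bounded linear operators between Banach spaces with a norm $\|\cdot\|_{\mathcal I}$ such that each $\mathcal I(E_0,E_1)=\mathcal I\cap L(E_0,E_1)$ is a normed space containing all finite rank operators, $\|SXR\|_{\mathcal I}\le\|S\|\|X\|_{\mathcal I}\|R\|$ (with $SXR$ in the ideal) for bounded $S,R$ and $X$ in the ideal, and rank one operators $x\mapsto x'(x)y$ have norm $\|x'\|\|y\|$. Here $\mathcal I$ also denotes the component $\mathcal I(E_0,E_1)$; in case (3) the norm is the operator norm. $T$ bounded below means $\|Tx\|\ge c\|x\|$ for some $c>0$ and all $x$. $f$ coercive means $f(t)\to\infty$ as $\|t\|\to\infty$ in $\mathbb R_{\ge0}^3$. *)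

theory Defs
  imports "HOL-Analysis.Analysis"
begin

definition infinite_dimensional :: "'a::real_vector itself \<Rightarrow> bool" where
  "infinite_dimensional _ \<longleftrightarrow> \<not> (\<exists>B::'a set. finite B \<and> span B = UNIV)"

text \<open>
  A component of an operator ideal is a linear subspace of \<open>'a \<Rightarrow>\<^sub>L 'b\<close> with a norm of its own,
  in general different from the operator norm. Hence norm, topology, completeness and reflexivity
  are needed for a pair of a subspace \<open>V\<close> and a function \<open>N\<close>, of which only the
  values on \<open>V\<close> matter. A Banach space \<open>'a\<close> is the pair \<open>UNIV\<close>, \<open>norm\<close>.
\<close>

definition normed_space_on :: "'v::real_vector set \<Rightarrow> ('v \<Rightarrow> real) \<Rightarrow> bool" where
  "normed_space_on V N \<longleftrightarrow>
     subspace V \<and>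
     (\<forall>x\<in>V. 0 \<le> N x) \<and>
     (\<forall>x\<in>V. N x = 0 \<longrightarrow> x = 0) \<and>
     (\<forall>a. \<forall>x\<in>V. N (a *\<^sub>R x) = \<bar>a\<bar> * N x) \<and>
     (\<forall>x\<in>V. \<forall>y\<in>V. N (x + y) \<le> N x + N y)"

text \<open>
  The locale \<open>Metric_space\<close> requires the distance to be nonnegative and symmetric
  off the carrier, too; hence the default value 0 there.
\<close>

definition norm_dist :: "'v::real_vector set \<Rightarrow> ('v \<Rightarrow> real) \<Rightarrow> 'v \<Rightarrow> 'v \<Rightarrow> real" where
  "norm_dist V N x y = (if x \<in> V \<and> y \<in> V then N (x - y) else 0)"

definition norm_topology :: "'v::real_vector set \<Rightarrow> ('v \<Rightarrow> real) \<Rightarrow> 'v topology" where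
  "norm_topology V N = Metric_space.mtopology V (norm_dist V N)"

definition banach_space_on :: "'v::real_vector set \<Rightarrow> ('v \<Rightarrow> real) \<Rightarrow> bool" where
  "banach_space_on V N \<longleftrightarrow>
     normed_space_on V N \<and> Metric_space.mcomplete V (norm_dist V N)"

text \<open>
  Functionals on \<open>V\<close> are represented by functions on the whole type that vanish off \<open>V\<close>, so
  that equality of functionals is equality of functions and the linear structure of the
  dual is pointwise.
\<close>

definition dual_on :: "'v::real_vector set \<Rightarrow> ('v \<Rightarrow> real) \<Rightarrow> ('v \<Rightarrow> real) set" where
  "dual_on V N =
     {g. (\<forall>x\<in>V. \<forall>y\<in>V. g (x + y) = g x + g y) \<and>
         (\<forall>a. \<forall>x\<in>V. g (a *\<^sub>R x) = a * g x) \<and>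
         (\<exists>K. \<forall>x\<in>V. \<bar>g x\<bar> \<le> K * N x) \<and>
         (\<forall>x. x \<notin> V \<longrightarrow> g x = 0)}"

definition dual_norm_on :: "'v::real_vector set \<Rightarrow> ('v \<Rightarrow> real) \<Rightarrow> ('v \<Rightarrow> real) \<Rightarrow> real" where
  "dual_norm_on V N g = Sup {\<bar>g x\<bar> |x. x \<in> V \<and> N x \<le> 1}"

text \<open>The canonical map into the bidual is onto.\<close>

definition reflexive_on :: "'v::real_vector set \<Rightarrow> ('v \<Rightarrow> real) \<Rightarrow> bool" where
  "reflexive_on V N \<longleftrightarrow>
     (\<forall>\<phi> :: ('v \<Rightarrow> real) \<Rightarrow> real.
        (\<forall>g\<in>dual_on V N. \<forall>h\<in>dual_on V N. \<phi> (\<lambda>x. g x + h x) = \<phi> g + \<phi> h) \<and>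
        (\<forall>a. \<forall>g\<in>dual_on V N. \<phi> (\<lambda>x. a * g x) = a * \<phi> g) \<and>
        (\<exists>K. \<forall>g\<in>dual_on V N. \<bar>\<phi> g\<bar> \<le> K * dual_norm_on V N g)
        \<longrightarrow> (\<exists>x\<in>V. \<forall>g\<in>dual_on V N. \<phi> g = g x))"

definition reflexive_space :: "'a::real_normed_vector itself \<Rightarrow> bool" where
  "reflexive_space _ \<longleftrightarrow> reflexive_on (UNIV :: 'a set) norm"

definition finite_rank :: "('a::real_normed_vector \<Rightarrow>\<^sub>L 'b::real_normed_vector) \<Rightarrow> bool" where
  "finite_rank X \<longleftrightarrow> (\<exists>B. finite B \<and> range (blinfun_apply X) \<subseteq> span B)"

definition rank_one :: "('a::real_normed_vector \<Rightarrow>\<^sub>L real) \<Rightarrow> 'b::real_normed_vector \<Rightarrow> 'a \<Rightarrow>\<^sub>L 'b" where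
  "rank_one x' y = blinfun_scaleR_left y o\<^sub>L x'"

text \<open>
  A normed ideal is a class of operators between all Banach spaces, and HOL cannot quantify over
  the types of these spaces. The predicate below describes its component \<open>I\<close> in
  \<open>L(E\<^sub>0,E\<^sub>1)\<close> with norm \<open>N\<close>; the products \<open>SXR\<close> that lie in this component again are those
  with \<open>S\<close> in \<open>L(E\<^sub>1,E\<^sub>1)\<close> and \<open>R\<close> in \<open>L(E\<^sub>0,E\<^sub>0)\<close>.
  Nothing is lost: every such pair \<open>I\<close>, \<open>N\<close> is the component of a normed ideal, namely of
  all finite sums of products \<open>S\<^sub>iX\<^sub>iR\<^sub>i\<close> with \<open>X\<^sub>i\<close> in \<open>I\<close>, normed by the infimum of the sums of
  \<open>\<parallel>S\<^sub>i\<parallel> N(X\<^sub>i) \<parallel>R\<^sub>i\<parallel>\<close> over all such representations.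
\<close>

definition normed_ideal_component ::
    "('a::banach \<Rightarrow>\<^sub>L 'b::banach) set \<Rightarrow> (('a \<Rightarrow>\<^sub>L 'b) \<Rightarrow> real) \<Rightarrow> bool" where
  "normed_ideal_component I N \<longleftrightarrow>
     normed_space_on I N \<and>
     (\<forall>X. finite_rank X \<longrightarrow> X \<in> I) \<and>
     (\<forall>S :: 'b \<Rightarrow>\<^sub>L 'b. \<forall>X\<in>I. \<forall>R :: 'a \<Rightarrow>\<^sub>L 'a.
        S o\<^sub>L X o\<^sub>L R \<in> I \<and> N (S o\<^sub>L X o\<^sub>L R) \<le> norm S * N X * norm R) \<and>
     (\<forall>x' y. N (rank_one x' y) = norm x' * norm y)"

definition nonneg3 :: "(real \<times> real \<times> real) set" where
  "nonneg3 = {0..} \<times> {0..} \<times> {0..}"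

definition increasing3 :: "(real \<times> real \<times> real \<Rightarrow> real) \<Rightarrow> bool" where
  "increasing3 f \<longleftrightarrow>
     (\<forall>s\<ge>0. \<forall>t\<ge>0. mono_on {0..} (\<lambda>r. f (r, s, t))) \<and>
     (\<forall>r\<ge>0. \<forall>t\<ge>0. mono_on {0..} (\<lambda>s. f (r, s, t))) \<and>
     (\<forall>r\<ge>0. \<forall>s\<ge>0. mono_on {0..} (\<lambda>t. f (r, s, t)))"

definition coercive3 :: "(real \<times> real \<times> real \<Rightarrow> real) \<Rightarrow> bool" where
  "coercive3 f \<longleftrightarrow> filterlim f at_top (inf at_infinity (principal nonneg3))"

definition bounded_below :: "('a::real_normed_vector \<Rightarrow>\<^sub>L 'b::real_normed_vector) \<Rightarrow> bool" where
  "bounded_below T \<longleftrightarrow> (\<exists>c>0. \<forall>x. norm (T x) \<ge> c * norm x)"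

end

theory Submission
  imports Defs
begin

text \<open>
  The proof is the direct method. Along a minimizing sequence \<open>(X\<^sub>n, x\<^sub>n)\<close> coercivity bounds the three
  arguments of \<open>f\<close>, so they converge to some \<open>(r, s, t)\<close> along a subsequence, where \<open>f\<close> takes the
  infimum as its value. Since \<open>f\<close> is increasing, it suffices to find a feasible pair whose arguments
  are at most \<open>r\<close>, \<open>s\<close>, \<open>t\<close> (lemma \<open>minimum_attained_if_lower_semicontinuous\<close>). In each of the three cases
  one of the factors has a subsequence that converges in norm, by compactness, and the other factor is
  bounded and has a weak limit, by reflexivity. Then \<open>X\<^sub>n x\<^sub>n - b\<close> converges weakly as well, and
  norms do not increase in a weak limit.

  Weak limits are taken along a generalized limit \<open>L\<close>, a linear functional on the bounded real
  sequences below the limit superior: \<open>z\<close> is the limit of \<open>z\<^sub>n\<close> if \<open>g z = L (g z\<^sub>n)\<close> for every bounded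
  functional \<open>g\<close>. For a bounded sequence the map \<open>g \<mapsto> L (g z\<^sub>n)\<close> belongs to the bidual, so in a
  reflexive space such a \<open>z\<close> exists immediately from the definition of reflexivity
  (\<open>reflexive_imp_weak_limit_exists\<close>); neither weak topologies nor subsequences enter. As \<open>L\<close> is fixed,
  weak limits depend linearly on the sequence. This matters if only the target space is reflexive:
  the pointwise weak limits of \<open>X\<^sub>n x\<close> then form a bounded operator (\<open>reflexive_target_weak_limit\<close>).

  Both the existence of \<open>L\<close> and the lower semicontinuity of norms rest on the Hahn--Banach theorem
  (\<open>linear_minorant_exists\<close>), stated for a sublinear functional on a subspace in order to cover operator ideals.
  The ideal norm and the other arguments are linked by \<open>norm_le_ideal_norm\<close>: it dominates the operator
  norm, so that evaluation at a point is weakly continuous on the ideal.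
\<close>

section \<open>Linear minorants of sublinear functionals\<close>

definition sublinear_on :: "'v::real_vector set \<Rightarrow> ('v \<Rightarrow> real) \<Rightarrow> bool" where
  "sublinear_on E p \<longleftrightarrow>
     (\<forall>x\<in>E. \<forall>y\<in>E. p (x + y) \<le> p x + p y) \<and> (\<forall>a\<ge>0. \<forall>x\<in>E. p (a *\<^sub>R x) = a * p x)"

text \<open>One inequality suffices for homogeneity: apply it to \<open>a\<close> and to \<open>1 / a\<close>.\<close>

lemma sublinear_onI:
  assumes E: "subspace E"
    and add: "\<And>x y. x \<in> E \<Longrightarrow> y \<in> E \<Longrightarrow> p (x + y) \<le> p x + p y"
    and scale: "\<And>a x. a > 0 \<Longrightarrow> x \<in> E \<Longrightarrow> p (a *\<^sub>R x) \<le> a * p x"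
    and zero: "p 0 = 0"
  shows "sublinear_on E p"
proof -
  have "p (a *\<^sub>R x) = a * p x" if a: "a \<ge> 0" and x: "x \<in> E" for a x
  proof (cases "a = 0")
    case True
    then show ?thesis by (simp add: zero)
  next
    case False
    then have a': "a > 0" using a by simp
    have "p (inverse a *\<^sub>R (a *\<^sub>R x)) \<le> inverse a * p (a *\<^sub>R x)"
      using a' x by (intro scale) (auto intro: subspace_scale[OF E])
    then have "a * p x \<le> p (a *\<^sub>R x)"
      using a' by (simp add: field_simps)
    then show ?thesis using scale[OF a' x] by simp
  qed
  then show ?thesis using add unfolding sublinear_on_def by blast
qed

lemma sublinear_on_add:
  "sublinear_on E p \<Longrightarrow> x \<in> E \<Longrightarrow> y \<in> E \<Longrightarrow> p (x + y) \<le> p x + p y"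
  by (simp add: sublinear_on_def)

lemma sublinear_on_scale:
  "sublinear_on E p \<Longrightarrow> a \<ge> 0 \<Longrightarrow> x \<in> E \<Longrightarrow> p (a *\<^sub>R x) = a * p x"
  by (simp add: sublinear_on_def)

lemma sublinear_on_zero:
  assumes "sublinear_on E p" "subspace E"
  shows "p 0 = 0"
  using sublinear_on_scale[of E p 0 0] assms subspace_0 by auto

lemma sublinear_on_neg:
  assumes p: "sublinear_on E p" and E: "subspace E" and x: "x \<in> E"
  shows "- p (- x) \<le> p x"
  using sublinear_on_add[OF p x subspace_neg[OF E x]] sublinear_on_zero[OF p E] by simp

text \<open>
  The largest sublinear functional \<open>q\<close> below \<open>p\<close> with \<open>q (- y) \<le> - p y\<close>. Passing from \<open>p\<close> to it
  makes the functional odd on the line through \<open>y\<close>.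
\<close>

definition linearize_along :: "('v::real_vector \<Rightarrow> real) \<Rightarrow> 'v \<Rightarrow> 'v \<Rightarrow> real" where
  "linearize_along p y x = (INF t\<in>{0..}. p (x + t *\<^sub>R y) - t * p y)"

lemma linearize_along_le:
  assumes p: "sublinear_on E p" and E: "subspace E" and y: "y \<in> E" and x: "x \<in> E" and t: "t \<ge> 0"
  shows "linearize_along p y x \<le> p (x + t *\<^sub>R y) - t * p y"
  unfolding linearize_along_def
proof (rule cINF_lower)
  show "bdd_below ((\<lambda>t. p (x + t *\<^sub>R y) - t * p y) ` {0..})"
  proof (rule bdd_belowI2)
    fix t :: real assume "t \<in> {0..}"
    then have t: "t \<ge> 0" by simp
    have "p ((x + t *\<^sub>R y) + (- x)) \<le> p (x + t *\<^sub>R y) + p (- x)"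
      using x y E by (intro sublinear_on_add[OF p]) (auto intro: subspace_add subspace_scale subspace_neg)
    then show "- p (- x) \<le> p (x + t *\<^sub>R y) - t * p y"
      using sublinear_on_scale[OF p t y] by simp
  qed
qed (use t in simp)

lemma linearize_along_greatest:
  assumes "\<And>t. t \<ge> 0 \<Longrightarrow> c \<le> p (x + t *\<^sub>R y) - t * p y"
  shows "c \<le> linearize_along p y x"
  unfolding linearize_along_def by (rule cINF_greatest) (use assms in auto)

lemma sublinear_on_linearize_along:
  assumes p: "sublinear_on E p" and E: "subspace E" and y: "y \<in> E"
  shows "sublinear_on E (linearize_along p y)"
proof (rule sublinear_onI[OF E])
  note mem = subspace_add[OF E] subspace_scale[OF E] y
  show "linearize_along p y (x + z) \<le> linearize_along p y x + linearize_along p y z"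
    if x: "x \<in> E" and z: "z \<in> E" for x z
  proof -
    have *: "linearize_along p y (x + z) \<le> (p (x + t *\<^sub>R y) - t * p y) + (p (z + s *\<^sub>R y) - s * p y)"
      if "t \<ge> 0" "s \<ge> 0" for t s
    proof -
      have "linearize_along p y (x + z) \<le> p ((x + z) + (t + s) *\<^sub>R y) - (t + s) * p y"
        using that x z by (intro linearize_along_le[OF p E y]) (auto intro: mem)
      also have "(x + z) + (t + s) *\<^sub>R y = (x + t *\<^sub>R y) + (z + s *\<^sub>R y)"
        by (simp add: algebra_simps)
      also have "p \<dots> \<le> p (x + t *\<^sub>R y) + p (z + s *\<^sub>R y)"
        using x z by (intro sublinear_on_add[OF p]) (auto intro: mem)
      finally show ?thesis by (simp add: algebra_simps)
    qed
    have "linearize_along p y (x + z) - (p (x + t *\<^sub>R y) - t * p y) \<le> linearize_along p y z"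
      if "t \<ge> 0" for t
      by (rule linearize_along_greatest) (use *[OF that] in force)
    then have "linearize_along p y (x + z) - linearize_along p y z \<le> linearize_along p y x"
      by (intro linearize_along_greatest) force
    then show ?thesis by simp
  qed
  show "linearize_along p y (a *\<^sub>R x) \<le> a * linearize_along p y x" if a: "a > 0" and x: "x \<in> E" for a x
  proof -
    have "inverse a * linearize_along p y (a *\<^sub>R x) \<le> p (x + t *\<^sub>R y) - t * p y" if t: "t \<ge> 0" for t
    proof -
      have "linearize_along p y (a *\<^sub>R x) \<le> p (a *\<^sub>R x + (a * t) *\<^sub>R y) - (a * t) * p y"
        using a t x by (intro linearize_along_le[OF p E y]) (auto intro: mem)
      also have "a *\<^sub>R x + (a * t) *\<^sub>R y = a *\<^sub>R (x + t *\<^sub>R y)"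
        by (simp add: algebra_simps)
      also have "p \<dots> = a * p (x + t *\<^sub>R y)"
        using a x by (intro sublinear_on_scale[OF p]) (auto intro: mem)
      finally show ?thesis using a by (simp add: field_simps)
    qed
    then have "inverse a * linearize_along p y (a *\<^sub>R x) \<le> linearize_along p y x"
      by (rule linearize_along_greatest)
    then show ?thesis using a by (simp add: field_simps)
  qed
  show "linearize_along p y 0 = 0"
  proof (rule antisym)
    show "linearize_along p y 0 \<le> 0"
      using linearize_along_le[OF p E y subspace_0[OF E], of 0] sublinear_on_zero[OF p E] by simp
    show "0 \<le> linearize_along p y 0"
      by (rule linearize_along_greatest) (simp add: sublinear_on_scale[OF p _ y])
  qed
qed

text \<open>
  By Zorn's lemma it is enough that a pointwise infimum of a chain of sublinear functionals is
  sublinear; it is finite because every \<open>q\<close> below \<open>p\<close> satisfies \<open>- p (- x) \<le> q x\<close>. The value 0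
  off \<open>E\<close> turns comparison on \<open>E\<close> into the pointwise order of functions on the whole type.
\<close>

lemma minimal_sublinear_exists:
  fixes p :: "'v::real_vector \<Rightarrow> real"
  assumes p: "sublinear_on E p" and E: "subspace E"
  shows "\<exists>q. sublinear_on E q \<and> (\<forall>x\<in>E. q x \<le> p x) \<and> (\<forall>x. x \<notin> E \<longrightarrow> q x = 0) \<and>
    (\<forall>r. sublinear_on E r \<longrightarrow> (\<forall>x\<in>E. r x \<le> q x) \<longrightarrow> (\<forall>x\<in>E. r x = q x))"
proof -
  define S where "S = {q. sublinear_on E q \<and> (\<forall>x\<in>E. q x \<le> p x) \<and> (\<forall>x. x \<notin> E \<longrightarrow> q x = 0)}"
  define cut where "cut = (\<lambda>r::'v \<Rightarrow> real. \<lambda>x. if x \<in> E then r x else 0)"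
  have cut: "sublinear_on E (cut r)" if "sublinear_on E r" for r
    using that subspace_add[OF E] subspace_scale[OF E] by (auto simp: sublinear_on_def cut_def)
  have lower: "- p (- x) \<le> q x" if "q \<in> S" "x \<in> E" for q x
    using that sublinear_on_neg[of E q x] E subspace_neg[OF E] by (fastforce simp: S_def)
  have "\<exists>m\<in>S. \<forall>a\<in>S. m \<ge> a \<longrightarrow> a = m"
  proof (rule predicate_Zorn)
    show "partial_order_on S (relation_of (\<ge>) S)"
      by (rule partial_order_on_relation_ofI) auto
  next
    fix \<C> assume chain: "\<C> \<in> Chains (relation_of (\<ge>) S)"
    then have sub: "\<C> \<subseteq> S" and lin: "\<And>a b. a \<in> \<C> \<Longrightarrow> b \<in> \<C> \<Longrightarrow> a \<le> b \<or> b \<le> a"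
      by (auto simp: Chains_def relation_of_def)
    show "\<exists>u\<in>S. \<forall>a\<in>\<C>. a \<ge> u"
    proof (cases "\<C> = {}")
      case True
      have "cut p \<in> S"
        using cut[OF p] by (auto simp: S_def cut_def)
      then show ?thesis using True by auto
    next
      case False
      define u where "u = cut (\<lambda>x. INF q\<in>\<C>. q x)"
      have u_le: "u x \<le> q x" if "q \<in> \<C>" for q x
      proof (cases "x \<in> E")
        case True
        have "bdd_below ((\<lambda>q. q x) ` \<C>)"
          by (rule bdd_belowI2[of _ "- p (- x)"]) (use lower True sub in auto)
        then show ?thesis
          using that True by (auto simp: u_def cut_def intro: cINF_lower)
      next
        case False
        then have "q x = 0" using that sub by (auto simp: S_def)
        then show ?thesis using False by (simp add: u_def cut_def)
      qed
      have u_greatest: "c \<le> u x" if "\<And>q. q \<in> \<C> \<Longrightarrow> c \<le> q x" "x \<in> E" for c x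
        using that False by (auto simp: u_def cut_def intro: cINF_greatest)
      have subl: "sublinear_on E q" if "q \<in> \<C>" for q
        using that sub by (auto simp: S_def)
      have "sublinear_on E u"
      proof (rule sublinear_onI[OF E])
        show "u (x + y) \<le> u x + u y" if x: "x \<in> E" and y: "y \<in> E" for x y
        proof -
          have xy: "x + y \<in> E" using x y subspace_add[OF E] by blast
          have *: "u (x + y) \<le> q x + r y" if q: "q \<in> \<C>" and r: "r \<in> \<C>" for q r
          proof -
            \<comment> \<open>The smaller of \<open>q\<close> and \<open>r\<close> is subadditive and below both.\<close>
            obtain s where s: "s \<in> \<C>" "s \<le> q" "s \<le> r" using lin[OF q r] q r by blast
            have "u (x + y) \<le> s (x + y)" by (rule u_le[OF s(1)])
            also have "\<dots> \<le> s x + s y" by (rule sublinear_on_add[OF subl[OF s(1)] x y])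
            also have "\<dots> \<le> q x + r y" using s by (auto simp: le_fun_def intro: add_mono)
            finally show ?thesis .
          qed
          have "u (x + y) - q x \<le> u y" if "q \<in> \<C>" for q
            by (rule u_greatest[OF _ y]) (use *[OF that] in force)
          then have "u (x + y) - u y \<le> u x"
            by (intro u_greatest[OF _ x]) force
          then show ?thesis by simp
        qed
        show "u (a *\<^sub>R x) \<le> a * u x" if a: "a > 0" and x: "x \<in> E" for a x
        proof -
          have "inverse a * u (a *\<^sub>R x) \<le> u x"
          proof (rule u_greatest[OF _ x])
            fix q assume q: "q \<in> \<C>"
            have "u (a *\<^sub>R x) \<le> a * q x"
              using u_le[OF q, of "a *\<^sub>R x"] sublinear_on_scale[OF subl[OF q] _ x, of a] a by simp
            then show "inverse a * u (a *\<^sub>R x) \<le> q x" using a by (simp add: field_simps)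
          qed
          then show ?thesis using a by (simp add: field_simps)
        qed
        have "q 0 = 0" if "q \<in> \<C>" for q
          using sublinear_on_zero[OF subl[OF that] E] .
        then have "(\<lambda>q. q 0) ` \<C> = {0}" using False by force
        then show "u 0 = 0"
          using subspace_0[OF E] by (simp add: u_def cut_def)
      qed
      moreover have "u x \<le> p x" if "x \<in> E" for x
      proof -
        obtain q where q: "q \<in> \<C>" using False by blast
        then show ?thesis using u_le[OF q, of x] sub that by (force simp: S_def)
      qed
      ultimately have "u \<in> S" by (auto simp: S_def u_def cut_def)
      then show ?thesis using u_le by (auto simp: le_fun_def)
    qed
  qed
  then obtain q where q: "q \<in> S" and min: "\<And>a. a \<in> S \<Longrightarrow> a \<le> q \<Longrightarrow> a = q" by blast
  have "r x = q x" if r: "sublinear_on E r" and le: "\<forall>x\<in>E. r x \<le> q x" and x: "x \<in> E" for r x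
  proof -
    have "cut r \<in> S" using cut[OF r] le q by (force simp: S_def cut_def)
    moreover have "cut r \<le> q" using le q by (auto simp: S_def cut_def le_fun_def)
    ultimately have "cut r = q" by (rule min)
    then show ?thesis using x by (metis cut_def)
  qed
  then show ?thesis using q by (auto simp: S_def)
qed

text \<open>
  This is the Hahn--Banach theorem for the line through \<open>x0\<close>. A minimal sublinear functional
  \<open>q\<close> is linear: linearizing it along any \<open>y\<close> does not change it, so that \<open>q x \<le> q (x + y) - q y\<close>.
  Starting from the functional that is linearized along \<open>x0\<close> fixes the value there.
\<close>

lemma linear_minorant_exists:
  fixes p :: "'v::real_vector \<Rightarrow> real"
  assumes p: "sublinear_on E p" and E: "subspace E" and x0: "x0 \<in> E"
  obtains g where "\<And>x y. x \<in> E \<Longrightarrow> y \<in> E \<Longrightarrow> g (x + y) = g x + g y"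
    "\<And>a x. x \<in> E \<Longrightarrow> g (a *\<^sub>R x) = a * g x"
    "\<And>x. x \<in> E \<Longrightarrow> g x \<le> p x" "\<And>x. x \<notin> E \<Longrightarrow> g x = 0" "g x0 = p x0"
proof -
  obtain q where q: "sublinear_on E q" and le: "\<forall>x\<in>E. q x \<le> linearize_along p x0 x"
    and off: "\<forall>x. x \<notin> E \<longrightarrow> q x = 0"
    and min: "\<forall>r. sublinear_on E r \<longrightarrow> (\<forall>x\<in>E. r x \<le> q x) \<longrightarrow> (\<forall>x\<in>E. r x = q x)"
    using minimal_sublinear_exists[OF sublinear_on_linearize_along[OF p E x0] E]
    by (elim exE conjE) (rule that)
  have le_p: "q x \<le> p x" if "x \<in> E" for x
    using bspec[OF le that] linearize_along_le[OF p E x0 that, of 0] by simp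
  have add: "q (x + y) = q x + q y" if x: "x \<in> E" and y: "y \<in> E" for x y
  proof -
    have "linearize_along q y z \<le> q z" if "z \<in> E" for z
      using linearize_along_le[OF q E y that, of 0] by simp
    then have "linearize_along q y x = q x"
      using min sublinear_on_linearize_along[OF q E y] x by blast
    then have "q x \<le> q (x + y) - q y"
      using linearize_along_le[OF q E y x, of 1] by simp
    then show ?thesis using sublinear_on_add[OF q x y] by simp
  qed
  have neg: "q (- x) = - q x" if "x \<in> E" for x
    using add[OF that subspace_neg[OF E that]] sublinear_on_zero[OF q E] by simp
  have scale: "q (a *\<^sub>R x) = a * q x" if x: "x \<in> E" for a x
  proof (cases "a \<ge> 0")
    case True
    then show ?thesis using sublinear_on_scale[OF q _ x] by simp
  next
    case False
    then have "q ((- a) *\<^sub>R x) = (- a) * q x" using sublinear_on_scale[OF q _ x, of "- a"] by simp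
    moreover have "q ((- a) *\<^sub>R x) = - q (a *\<^sub>R x)"
      using neg[OF subspace_scale[OF E x, of a]] by simp
    ultimately show ?thesis by simp
  qed
  have "q (- x0) \<le> p (- x0 + 1 *\<^sub>R x0) - 1 * p x0"
    using bspec[OF le subspace_neg[OF E x0]] linearize_along_le[OF p E x0 subspace_neg[OF E x0], of 1] by simp
  then have "p x0 \<le> q x0"
    using neg[OF x0] sublinear_on_zero[OF p E] by simp
  then have "q x0 = p x0" using le_p[OF x0] by simp
  then show thesis using off by (intro that[of q] add scale le_p) auto
qed

section \<open>Generalized limits of bounded sequences\<close>

text \<open>
  These are Banach limits without shift invariance. The last condition is \<open>L s \<le> lim sup s\<close>; applied
  to \<open>- s\<close> it makes \<open>L\<close> agree with the ordinary limit of a convergent sequence.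
\<close>

definition generalized_limit :: "((nat \<Rightarrow> real) \<Rightarrow> real) \<Rightarrow> bool" where
  "generalized_limit L \<longleftrightarrow>
     (\<forall>s t. Bseq s \<longrightarrow> Bseq t \<longrightarrow> L (\<lambda>n. s n + t n) = L s + L t) \<and>
     (\<forall>a s. Bseq s \<longrightarrow> L (\<lambda>n. a * s n) = a * L s) \<and>
     (\<forall>s c. Bseq s \<longrightarrow> eventually (\<lambda>n. s n \<le> c) sequentially \<longrightarrow> L s \<le> c)"

text \<open>
  A generalized limit is a linear minorant of the limit superior, a sublinear functional on the
  space of bounded sequences; these are the bounded continuous functions on the discrete
  space of natural numbers.
\<close>

lemma generalized_limit_exists: "\<exists>L. generalized_limit L"
proof -
  define U :: "(nat \<Rightarrow>\<^sub>C real) \<Rightarrow> real set" where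
    "U s = {c. eventually (\<lambda>n. s n \<le> c) sequentially}" for s
  have bound: "\<exists>B. \<forall>n. \<bar>apply_bcontfun s n\<bar> \<le> B" for s :: "nat \<Rightarrow>\<^sub>C real"
    using bounded_apply_bcontfun[of s] by (auto simp: bounded_iff)
  have ne: "U s \<noteq> {}" for s
  proof -
    obtain B where "\<And>n. \<bar>apply_bcontfun s n\<bar> \<le> B" using bound by blast
    then have "B \<in> U s" unfolding U_def by (auto simp: abs_le_iff)
    then show ?thesis by blast
  qed
  have bdd: "bdd_below (U s)" for s
  proof -
    obtain B where B: "\<And>n. \<bar>apply_bcontfun s n\<bar> \<le> B" using bound by blast
    have "- B \<le> c" if c: "c \<in> U s" for c
    proof -
      obtain n where "apply_bcontfun s n \<le> c"
        using c by (auto simp: U_def eventually_sequentially)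
      then show ?thesis using B[of n] by linarith
    qed
    then show ?thesis by (rule bdd_belowI)
  qed
  define p where "p s = Inf (U s)" for s
  have p_le: "p s \<le> c" if "c \<in> U s" for s c
    unfolding p_def by (rule cInf_lower[OF that bdd])
  have p_greatest: "c \<le> p s" if "\<And>d. d \<in> U s \<Longrightarrow> c \<le> d" for s c
    unfolding p_def by (rule cInf_greatest[OF ne that])
  have "sublinear_on UNIV p"
  proof (rule sublinear_onI)
    fix s t
    have *: "p (s + t) \<le> c + d" if "c \<in> U s" "d \<in> U t" for c d
    proof (rule p_le)
      have "eventually (\<lambda>n. s n \<le> c \<and> t n \<le> d) sequentially"
        using that by (simp add: U_def eventually_conj)
      then have "eventually (\<lambda>n. (s + t) n \<le> c + d) sequentially"
        by (rule eventually_mono) simp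
      then show "c + d \<in> U (s + t)" by (simp add: U_def)
    qed
    have "p (s + t) - c \<le> p t" if "c \<in> U s" for c
      by (rule p_greatest) (use *[OF that] in force)
    then have "p (s + t) - p t \<le> p s"
      by (intro p_greatest) force
    then show "p (s + t) \<le> p s + p t" by simp
  next
    fix a :: real and s assume a: "a > 0"
    have "inverse a * p (a *\<^sub>R s) \<le> p s"
    proof (rule p_greatest)
      fix c assume "c \<in> U s"
      then have "a * c \<in> U (a *\<^sub>R s)"
        using a by (simp add: U_def)
      then have "p (a *\<^sub>R s) \<le> a * c" by (rule p_le)
      then show "inverse a * p (a *\<^sub>R s) \<le> c" using a by (simp add: field_simps)
    qed
    then show "p (a *\<^sub>R s) \<le> a * p s" using a by (simp add: field_simps)
  next
    have "U 0 = {0..}" by (auto simp: U_def)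
    then show "p 0 = 0" by (simp add: p_def)
  qed simp
  then obtain g where add: "\<And>s t. g (s + t) = g s + g t" and scale: "\<And>a s. g (a *\<^sub>R s) = a * g s"
    and le: "\<And>s. g s \<le> p s"
    by (rule linear_minorant_exists[OF _ subspace_UNIV UNIV_I[of 0]]) auto
  have apply_B: "apply_bcontfun (Bcontfun s) = s" if "Bseq s" for s :: "nat \<Rightarrow> real"
  proof -
    have "bounded (range s)" using that by (simp add: Bseq_eq_bounded)
    then show ?thesis by (intro Bcontfun_inverse) (simp add: bcontfun_def)
  qed
  have "generalized_limit (\<lambda>s. g (Bcontfun s))"
    unfolding generalized_limit_def
  proof (intro conjI allI impI)
    fix s t :: "nat \<Rightarrow> real" assume st: "Bseq s" "Bseq t"
    then have "Bseq (\<lambda>n. s n + t n)" by (simp add: Bseq_eq_bounded bounded_plus_comp)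
    then have "Bcontfun (\<lambda>n. s n + t n) = Bcontfun s + Bcontfun t"
      by (intro bcontfun_eqI) (simp add: apply_B st)
    then show "g (Bcontfun (\<lambda>n. s n + t n)) = g (Bcontfun s) + g (Bcontfun t)"
      by (simp add: add)
  next
    fix a :: real and s :: "nat \<Rightarrow> real" assume s: "Bseq s"
    have "Bseq (\<lambda>n. a * s n)" by (rule Bseq_mult[OF Bfun_const s])
    then have "Bcontfun (\<lambda>n. a * s n) = a *\<^sub>R Bcontfun s"
      by (intro bcontfun_eqI) (simp add: apply_B s)
    then show "g (Bcontfun (\<lambda>n. a * s n)) = a * g (Bcontfun s)"
      by (simp add: scale)
  next
    fix s :: "nat \<Rightarrow> real" and c assume "Bseq s" "eventually (\<lambda>n. s n \<le> c) sequentially"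
    then have "c \<in> U (Bcontfun s)" by (simp add: U_def apply_B)
    then show "g (Bcontfun s) \<le> c" by (rule order_trans[OF le p_le])
  qed
  then show ?thesis by blast
qed

section \<open>Weak limits along a generalized limit\<close>

lemma
  assumes "normed_space_on V N"
  shows normed_space_on_subspace: "subspace V"
    and normed_space_on_nonneg: "x \<in> V \<Longrightarrow> 0 \<le> N x"
    and normed_space_on_eq_0: "x \<in> V \<Longrightarrow> N x = 0 \<Longrightarrow> x = 0"
    and normed_space_on_scale: "x \<in> V \<Longrightarrow> N (a *\<^sub>R x) = \<bar>a\<bar> * N x"
    and normed_space_on_triangle: "x \<in> V \<Longrightarrow> y \<in> V \<Longrightarrow> N (x + y) \<le> N x + N y"
  using assms by (auto simp: normed_space_on_def)

lemma normed_space_on_minus_commute: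
  assumes V: "normed_space_on V N" and x: "x \<in> V" and y: "y \<in> V"
  shows "N (x - y) = N (y - x)"
  using normed_space_on_scale[OF V subspace_diff[OF normed_space_on_subspace[OF V] x y], of "-1"] by simp

lemma normed_space_on_UNIV: "normed_space_on UNIV (norm :: 'a::real_normed_vector \<Rightarrow> real)"
  by (simp add: normed_space_on_def norm_triangle_ineq)

lemma
  assumes "g \<in> dual_on V N"
  shows dual_on_add: "x \<in> V \<Longrightarrow> y \<in> V \<Longrightarrow> g (x + y) = g x + g y"
    and dual_on_scale: "x \<in> V \<Longrightarrow> g (a *\<^sub>R x) = a * g x"
  using assms by (auto simp: dual_on_def)

lemma dual_on_bound:
  assumes V: "normed_space_on V N" and g: "g \<in> dual_on V N"
  obtains K where "K \<ge> 0" "\<And>x. x \<in> V \<Longrightarrow> \<bar>g x\<bar> \<le> K * N x"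
proof -
  from g obtain K where K: "\<forall>x\<in>V. \<bar>g x\<bar> \<le> K * N x" by (auto simp: dual_on_def)
  show thesis
  proof (rule that)
    fix x assume x: "x \<in> V"
    have "K * N x \<le> \<bar>K\<bar> * N x"
      using normed_space_on_nonneg[OF V x] by (intro mult_right_mono) auto
    then show "\<bar>g x\<bar> \<le> \<bar>K\<bar> * N x" using bspec[OF K x] by linarith
  qed simp
qed

lemma dual_on_diff:
  assumes g: "g \<in> dual_on V N" and V: "normed_space_on V N" and x: "x \<in> V" and y: "y \<in> V"
  shows "g (x - y) = g x - g y"
  using dual_on_add[OF g x subspace_neg[OF normed_space_on_subspace[OF V] y]]
    dual_on_scale[OF g y, of "-1"] by simp

lemma dual_on_Bseq:
  assumes V: "normed_space_on V N" and g: "g \<in> dual_on V N" and z: "\<And>n. z n \<in> V" and B: "\<And>n. N (z n) \<le> B"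
  shows "Bseq (\<lambda>n. g (z n))"
proof -
  obtain K where K: "K \<ge> 0" "\<And>x. x \<in> V \<Longrightarrow> \<bar>g x\<bar> \<le> K * N x"
    by (rule dual_on_bound[OF V g]) (rule that)
  have "\<bar>g (z n)\<bar> \<le> K * B" for n
    using order_trans[OF K(2)[OF z] mult_left_mono[OF B K(1)]] .
  then show ?thesis by (intro BseqI') auto
qed

text \<open>By the Hahn--Banach theorem, applied to the norm itself.\<close>

lemma norming_functional_exists:
  assumes V: "normed_space_on V N" and x0: "x0 \<in> V"
  obtains g where "g \<in> dual_on V N" "\<And>x. x \<in> V \<Longrightarrow> \<bar>g x\<bar> \<le> N x" "g x0 = N x0"
proof -
  have E: "subspace V" by (rule normed_space_on_subspace[OF V])
  have "sublinear_on V N"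
    using normed_space_on_scale[OF V] normed_space_on_triangle[OF V] by (auto simp: sublinear_on_def)
  from this E x0 obtain g where
    add: "\<And>x y. x \<in> V \<Longrightarrow> y \<in> V \<Longrightarrow> g (x + y) = g x + g y" and
    scale: "\<And>a x. x \<in> V \<Longrightarrow> g (a *\<^sub>R x) = a * g x" and
    le: "\<And>x. x \<in> V \<Longrightarrow> g x \<le> N x" and off: "\<And>x. x \<notin> V \<Longrightarrow> g x = 0" and eq: "g x0 = N x0"
    by (rule linear_minorant_exists) (rule that)
  have abs: "\<bar>g x\<bar> \<le> N x" if x: "x \<in> V" for x
    using le[OF x] le[OF subspace_neg[OF E x]] scale[OF x, of "-1"]
      normed_space_on_scale[OF V x, of "-1"] by simp
  have "\<exists>K. \<forall>x\<in>V. \<bar>g x\<bar> \<le> K * N x" by (rule exI[of _ 1]) (use abs in simp)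
  then have "g \<in> dual_on V N" using add scale off unfolding dual_on_def by simp
  then show thesis using that abs eq by blast
qed

lemma
  assumes "generalized_limit L"
  shows generalized_limit_add: "Bseq s \<Longrightarrow> Bseq t \<Longrightarrow> L (\<lambda>n. s n + t n) = L s + L t"
    and generalized_limit_scale: "Bseq s \<Longrightarrow> L (\<lambda>n. a * s n) = a * L s"
    and generalized_limit_le: "Bseq s \<Longrightarrow> eventually (\<lambda>n. s n \<le> c) sequentially \<Longrightarrow> L s \<le> c"
  using assms by (auto simp: generalized_limit_def)

lemma generalized_limit_abs_le:
  assumes L: "generalized_limit L" and s: "Bseq s"
    and le: "eventually (\<lambda>n. \<bar>s n\<bar> \<le> c) sequentially"
  shows "\<bar>L s\<bar> \<le> c"
proof -
  have "L s \<le> c"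
    by (rule generalized_limit_le[OF L s]) (use le in \<open>auto elim: eventually_mono\<close>)
  moreover have "L (\<lambda>n. - s n) \<le> c"
    using s le by (intro generalized_limit_le[OF L]) (auto simp: Bseq_minus_iff elim: eventually_mono)
  moreover have "L (\<lambda>n. - s n) = - L s" using generalized_limit_scale[OF L s, of "-1"] by simp
  ultimately show ?thesis by linarith
qed

lemma generalized_limit_eq_limit:
  assumes L: "generalized_limit L" and s: "s \<longlonglongrightarrow> l"
  shows "L s = l"
proof -
  have B: "Bseq s" using s by (rule convergent_imp_Bseq[OF convergentI])
  have "L s \<le> l + e" if "e > 0" for e
    using order_tendstoD(2)[OF s, of "l + e"] that
    by (intro generalized_limit_le[OF L B]) (auto elim: eventually_mono)
  moreover have "L (\<lambda>n. - s n) \<le> - l + e" if "e > 0" for e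
    using order_tendstoD(1)[OF s, of "l - e"] that B
    by (intro generalized_limit_le[OF L]) (auto simp: Bseq_minus_iff elim: eventually_mono)
  then have "l \<le> L s + e" if "e > 0" for e
    using generalized_limit_scale[OF L B, of "-1"] that by fastforce
  ultimately show ?thesis by (meson antisym field_le_epsilon)
qed

text \<open>
  Unlike weak convergence, this notion needs no passage to subsequences or subnets: in a reflexive
  space every bounded sequence has such a limit. Boundedness is part of the definition because
  a generalized limit is controlled on bounded sequences only.
\<close>

definition weak_limit ::
    "((nat \<Rightarrow> real) \<Rightarrow> real) \<Rightarrow> 'v::real_vector set \<Rightarrow> ('v \<Rightarrow> real) \<Rightarrow> (nat \<Rightarrow> 'v) \<Rightarrow> 'v \<Rightarrow> bool" where
  "weak_limit L V N z z0 \<longleftrightarrow>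
     z0 \<in> V \<and> (\<forall>n. z n \<in> V) \<and> (\<exists>B. \<forall>n. N (z n) \<le> B) \<and>
     (\<forall>g\<in>dual_on V N. g z0 = L (\<lambda>n. g (z n)))"

lemma
  assumes "weak_limit L V N z z0"
  shows weak_limit_mem: "z0 \<in> V" and weak_limit_seq_mem: "z n \<in> V"
    and weak_limit_bounded: "\<exists>B. \<forall>n. N (z n) \<le> B"
    and weak_limit_functional: "g \<in> dual_on V N \<Longrightarrow> g z0 = L (\<lambda>n. g (z n))"
  using assms by (auto simp: weak_limit_def)

lemma weak_limit_Bseq:
  assumes V: "normed_space_on V N" and z: "weak_limit L V N z z0" and g: "g \<in> dual_on V N"
  shows "Bseq (\<lambda>n. g (z n))"
proof -
  obtain B where "\<And>n. N (z n) \<le> B" using weak_limit_bounded[OF z] by blast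
  then show ?thesis by (rule dual_on_Bseq[OF V g weak_limit_seq_mem[OF z]])
qed

lemma abs_le_dual_norm_on:
  assumes V: "normed_space_on V N" and g: "g \<in> dual_on V N" and x: "x \<in> V" "N x \<le> 1"
  shows "\<bar>g x\<bar> \<le> dual_norm_on V N g"
  unfolding dual_norm_on_def
proof (rule cSup_upper)
  obtain K where K: "K \<ge> 0" "\<And>x. x \<in> V \<Longrightarrow> \<bar>g x\<bar> \<le> K * N x"
    by (rule dual_on_bound[OF V g]) (rule that)
  show "bdd_above {\<bar>g x\<bar> |x. x \<in> V \<and> N x \<le> 1}"
  proof (rule bdd_aboveI)
    fix r assume "r \<in> {\<bar>g x\<bar> |x. x \<in> V \<and> N x \<le> 1}"
    then obtain y where y: "r = \<bar>g y\<bar>" "y \<in> V" "N y \<le> 1" by blast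
    show "r \<le> K * 1"
      using order_trans[OF K(2)[OF y(2)] mult_left_mono[OF y(3) K(1)]] y(1) by simp
  qed
qed (use x in blast)

lemma dual_norm_on_bound:
  assumes V: "normed_space_on V N" and g: "g \<in> dual_on V N" and x: "x \<in> V" "N x \<le> B"
  shows "\<bar>g x\<bar> \<le> B * dual_norm_on V N g"
proof (cases "B = 0")
  case True
  then have "x = 0" using normed_space_on_nonneg[OF V x(1)] normed_space_on_eq_0[OF V x(1)] x by simp
  then show ?thesis using dual_on_scale[OF g x(1), of 0] True by simp
next
  case False
  then have pos: "B > 0" using normed_space_on_nonneg[OF V x(1)] x by simp
  have "\<bar>g (inverse B *\<^sub>R x)\<bar> \<le> dual_norm_on V N g"
  proof (rule abs_le_dual_norm_on[OF V g])
    show "inverse B *\<^sub>R x \<in> V"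
      by (rule subspace_scale[OF normed_space_on_subspace[OF V] x(1)])
    show "N (inverse B *\<^sub>R x) \<le> 1"
      using normed_space_on_scale[OF V x(1)] pos x(2) by (simp add: field_simps)
  qed
  then show ?thesis
    using dual_on_scale[OF g x(1)] pos by (simp add: abs_mult field_simps)
qed

text \<open>
  The map \<open>g \<mapsto> L (\<lambda>n. g (z n))\<close> is a bounded functional on the dual, hence the evaluation at
  a point of the space.
\<close>

lemma reflexive_imp_weak_limit_exists:
  assumes L: "generalized_limit L" and V: "normed_space_on V N" and R: "reflexive_on V N"
    and z: "\<And>n. z n \<in> V" and B: "\<And>n. N (z n) \<le> B"
  obtains z0 where "weak_limit L V N z z0"
proof -
  define \<phi> where "\<phi> g = L (\<lambda>n. g (z n))" for g
  have bseq: "Bseq (\<lambda>n. g (z n))" if "g \<in> dual_on V N" for g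
    by (rule dual_on_Bseq[OF V that z B])
  have "\<forall>g\<in>dual_on V N. \<forall>h\<in>dual_on V N. \<phi> (\<lambda>x. g x + h x) = \<phi> g + \<phi> h"
    using generalized_limit_add[OF L] bseq by (simp add: \<phi>_def)
  moreover have "\<forall>a. \<forall>g\<in>dual_on V N. \<phi> (\<lambda>x. a * g x) = a * \<phi> g"
    using generalized_limit_scale[OF L] bseq by (simp add: \<phi>_def)
  moreover have "\<bar>\<phi> g\<bar> \<le> B * dual_norm_on V N g" if g: "g \<in> dual_on V N" for g
    unfolding \<phi>_def
    using dual_norm_on_bound[OF V g z B] by (intro generalized_limit_abs_le[OF L bseq[OF g]]) simp
  ultimately obtain z0 where "z0 \<in> V" "\<forall>g\<in>dual_on V N. \<phi> g = g z0"
    using R unfolding reflexive_on_def by blast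
  then have "weak_limit L V N z z0"
    using z B unfolding weak_limit_def \<phi>_def by auto
  then show thesis by (rule that)
qed

text \<open>Weak lower semicontinuity of the norm: test with a functional that norms the limit.\<close>

lemma weak_limit_norm_le:
  assumes L: "generalized_limit L" and V: "normed_space_on V N" and z: "weak_limit L V N z z0"
    and le: "eventually (\<lambda>n. N (z n) \<le> c) sequentially"
  shows "N z0 \<le> c"
proof -
  obtain g where g: "g \<in> dual_on V N" "\<And>x. x \<in> V \<Longrightarrow> \<bar>g x\<bar> \<le> N x" "g z0 = N z0"
    using norming_functional_exists[OF V weak_limit_mem[OF z]] by blast
  have "L (\<lambda>n. g (z n)) \<le> c"
  proof (rule generalized_limit_le[OF L weak_limit_Bseq[OF V z g(1)]])
    show "eventually (\<lambda>n. g (z n) \<le> c) sequentially"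
      using le by (rule eventually_mono) (use g(2)[OF weak_limit_seq_mem[OF z]] in \<open>smt (verit)\<close>)
  qed
  then show ?thesis using weak_limit_functional[OF z g(1)] g(3) by simp
qed

lemma weak_limit_norm_le_limit:
  assumes L: "generalized_limit L" and V: "normed_space_on V N" and z: "weak_limit L V N z z0"
    and lim: "(\<lambda>n. N (z n)) \<longlonglongrightarrow> t"
  shows "N z0 \<le> t"
proof (rule field_le_epsilon)
  fix e :: real assume "e > 0"
  then show "N z0 \<le> t + e"
    using order_tendstoD(2)[OF lim, of "t + e"]
    by (intro weak_limit_norm_le[OF L V z]) (auto elim: eventually_mono)
qed

text \<open>
  Bounded linear maps are weakly continuous, because they pull bounded functionals back to bounded
  functionals. The two norms may belong to different subspaces, so that evaluation of the operators
  in an ideal at a point is an instance.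
\<close>

lemma weak_limit_image:
  assumes V: "normed_space_on V N" and W: "normed_space_on W M" and z: "weak_limit L V N z z0"
    and mem: "\<And>x. x \<in> V \<Longrightarrow> u x \<in> W"
    and add: "\<And>x y. x \<in> V \<Longrightarrow> y \<in> V \<Longrightarrow> u (x + y) = u x + u y"
    and scale: "\<And>a x. x \<in> V \<Longrightarrow> u (a *\<^sub>R x) = a *\<^sub>R u x"
    and bound: "\<And>x. x \<in> V \<Longrightarrow> M (u x) \<le> K * N x"
  shows "weak_limit L W M (\<lambda>n. u (z n)) (u z0)"
proof -
  note z_mem = weak_limit_mem[OF z] weak_limit_seq_mem[OF z]
  have le: "M (u x) \<le> \<bar>K\<bar> * N x" if "x \<in> V" for x
  proof -
    have "K * N x \<le> \<bar>K\<bar> * N x"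
      using normed_space_on_nonneg[OF V that] by (intro mult_right_mono) auto
    then show ?thesis using bound[OF that] by linarith
  qed
  obtain B where B: "\<And>n. N (z n) \<le> B" using weak_limit_bounded[OF z] by blast
  have "M (u (z n)) \<le> \<bar>K\<bar> * B" for n
    using le[OF z_mem(2)[of n]] mult_left_mono[OF B[of n], of "\<bar>K\<bar>"] by simp
  moreover have "g (u z0) = L (\<lambda>n. g (u (z n)))" if g: "g \<in> dual_on W M" for g
  proof -
    define h where "h x = (if x \<in> V then g (u x) else 0)" for x
    obtain K' where K': "K' \<ge> 0" "\<And>y. y \<in> W \<Longrightarrow> \<bar>g y\<bar> \<le> K' * M y"
      by (rule dual_on_bound[OF W g]) (rule that)
    have "\<bar>h x\<bar> \<le> (K' * \<bar>K\<bar>) * N x" if x: "x \<in> V" for x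
      using order_trans[OF K'(2)[OF mem[OF x]] mult_left_mono[OF le[OF x] K'(1)]] x
      by (simp add: h_def mult.assoc)
    then have bnd: "\<exists>K. \<forall>x\<in>V. \<bar>h x\<bar> \<le> K * N x" by blast
    have "h (x + y) = h x + h y" if "x \<in> V" "y \<in> V" for x y
      using that add dual_on_add[OF g mem mem] subspace_add[OF normed_space_on_subspace[OF V]]
      by (simp add: h_def)
    moreover have "h (a *\<^sub>R x) = a * h x" if "x \<in> V" for a x
      using that scale dual_on_scale[OF g mem] subspace_scale[OF normed_space_on_subspace[OF V]]
      by (simp add: h_def)
    ultimately have "h \<in> dual_on V N" using bnd unfolding dual_on_def by (simp add: h_def)
    from weak_limit_functional[OF z this] show ?thesis using z_mem by (simp add: h_def)
  qed
  ultimately show ?thesis using z_mem mem unfolding weak_limit_def by blast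
qed

lemma weak_limit_blinfun_apply:
  assumes "weak_limit L UNIV norm z z0"
  shows "weak_limit L UNIV norm (\<lambda>n. blinfun_apply X (z n)) (X z0)"
  by (rule weak_limit_image[OF normed_space_on_UNIV normed_space_on_UNIV assms, where K = "norm X"])
    (auto simp: blinfun.add_right blinfun.scaleR_right norm_blinfun)

text \<open>
  The form of the hypothesis covers both a perturbation that tends to 0 in norm and a translation.
\<close>

lemma weak_limit_perturb:
  assumes L: "generalized_limit L" and V: "normed_space_on V N" and z: "weak_limit L V N z z0"
    and w0: "w0 \<in> V" and w: "\<And>n. w n \<in> V"
    and lim: "(\<lambda>n. N ((w n - w0) - (z n - z0))) \<longlonglongrightarrow> 0"
  shows "weak_limit L V N w w0"
proof -
  have E: "subspace V" by (rule normed_space_on_subspace[OF V])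
  note mem = weak_limit_mem[OF z] weak_limit_seq_mem[OF z] w0 w subspace_diff[OF E] subspace_add[OF E]
  define d where "d n = (w n - w0) - (z n - z0)" for n
  have d: "d n \<in> V" for n unfolding d_def by (intro mem)
  obtain B where B: "\<And>n. N (z n) \<le> B" using weak_limit_bounded[OF z] by blast
  obtain B' where B': "\<And>n. N (d n) \<le> B'"
  proof -
    have "Bseq (\<lambda>n. N (d n))"
      using lim by (intro convergent_imp_Bseq convergentI) (simp add: d_def)
    then show thesis using that by (auto simp: Bseq_def abs_le_iff)
  qed
  have "N (w n) \<le> B' + B + N (w0 - z0)" for n
  proof -
    have "N ((d n + z n) + (w0 - z0)) \<le> N (d n + z n) + N (w0 - z0)"
      by (intro normed_space_on_triangle[OF V] mem d)
    moreover have "N (d n + z n) \<le> N (d n) + N (z n)"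
      by (intro normed_space_on_triangle[OF V] mem d)
    moreover have "(d n + z n) + (w0 - z0) = w n" by (simp add: d_def)
    ultimately show ?thesis using B[of n] B'[of n] by simp
  qed
  moreover have "g w0 = L (\<lambda>n. g (w n))" if g: "g \<in> dual_on V N" for g
  proof -
    obtain K where K: "\<And>x. x \<in> V \<Longrightarrow> \<bar>g x\<bar> \<le> K * N x"
      by (rule dual_on_bound[OF V g]) (rule that)
    have "(\<lambda>n. K * N (d n)) \<longlonglongrightarrow> 0"
      using tendsto_mult_left[OF lim, of K] by (simp add: d_def)
    then have "(\<lambda>n. g (d n)) \<longlonglongrightarrow> 0"
      by (rule Lim_null_comparison[rotated]) (use K[OF d] in simp)
    then have gd: "(\<lambda>n. g (d n) + g (w0 - z0)) \<longlonglongrightarrow> 0 + g (w0 - z0)" by (intro tendsto_intros)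
    have "g (w n) = g (z n) + (g (d n) + g (w0 - z0))" for n
    proof -
      have "g (z n + (d n + (w0 - z0))) = g (z n) + (g (d n) + g (w0 - z0))"
        using dual_on_add[OF g] mem d by simp
      then show ?thesis by (simp add: d_def)
    qed
    then have "L (\<lambda>n. g (w n)) = L (\<lambda>n. g (z n)) + L (\<lambda>n. g (d n) + g (w0 - z0))"
      using generalized_limit_add[OF L weak_limit_Bseq[OF V z g]
          convergent_imp_Bseq[OF convergentI[OF gd]]] by simp
    also have "\<dots> = g z0 + g (w0 - z0)"
      using weak_limit_functional[OF z g] generalized_limit_eq_limit[OF L gd] by simp
    also have "\<dots> = g w0" using dual_on_diff[OF g V] mem by simp
    finally show ?thesis by simp
  qed
  ultimately show ?thesis using w w0 unfolding weak_limit_def by blast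
qed

lemma weak_limit_add:
  assumes L: "generalized_limit L" and V: "normed_space_on V N"
    and z: "weak_limit L V N z z0" and w: "weak_limit L V N w w0"
  shows "weak_limit L V N (\<lambda>n. z n + w n) (z0 + w0)"
proof -
  note mem = weak_limit_mem[OF z] weak_limit_mem[OF w] weak_limit_seq_mem[OF z] weak_limit_seq_mem[OF w]
  obtain B B' where B: "\<And>n. N (z n) \<le> B" "\<And>n. N (w n) \<le> B'"
    using weak_limit_bounded[OF z] weak_limit_bounded[OF w] by blast
  have "N (z n + w n) \<le> B + B'" for n
    using normed_space_on_triangle[OF V mem(3) mem(4), of n n] B[of n] by linarith
  moreover have "g (z0 + w0) = L (\<lambda>n. g (z n + w n))" if g: "g \<in> dual_on V N" for g
    using dual_on_add[OF g] mem weak_limit_functional[OF z g] weak_limit_functional[OF w g]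
      generalized_limit_add[OF L weak_limit_Bseq[OF V z g] weak_limit_Bseq[OF V w g]] by simp
  ultimately show ?thesis
    using mem subspace_add[OF normed_space_on_subspace[OF V]] unfolding weak_limit_def by blast
qed

text \<open>Functionals separate points, by the Hahn--Banach theorem.\<close>

lemma weak_limit_unique:
  assumes V: "normed_space_on V N" and z: "weak_limit L V N z z0" and w: "weak_limit L V N z w0"
  shows "z0 = w0"
proof -
  note mem = weak_limit_mem[OF z] weak_limit_mem[OF w]
  have diff: "z0 - w0 \<in> V" by (rule subspace_diff[OF normed_space_on_subspace[OF V] mem])
  obtain g where g: "g \<in> dual_on V N" "g (z0 - w0) = N (z0 - w0)"
    using norming_functional_exists[OF V diff] by blast
  have "g (z0 - w0) = 0"
    using dual_on_diff[OF g(1) V mem] weak_limit_functional[OF z g(1)] weak_limit_functional[OF w g(1)]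
    by simp
  then show ?thesis using normed_space_on_eq_0[OF V diff] g(2) by simp
qed

section \<open>The direct method for the objective function\<close>

lemma increasing3_mono:
  assumes f: "increasing3 f" and nonneg: "0 \<le> r" "0 \<le> s" "0 \<le> t"
    and le: "r \<le> r'" "s \<le> s'" "t \<le> t'"
  shows "f (r, s, t) \<le> f (r', s', t')"
proof -
  have nonneg': "0 \<le> r'" "0 \<le> s'" using nonneg le by linarith+
  have "f (r, s, t) \<le> f (r', s, t)"
    using f nonneg le nonneg' unfolding increasing3_def mono_on_def by auto
  also have "\<dots> \<le> f (r', s', t)"
    using f nonneg le nonneg' unfolding increasing3_def mono_on_def by auto
  also have "\<dots> \<le> f (r', s', t')"
    using f nonneg le nonneg' unfolding increasing3_def mono_on_def by auto
  finally show ?thesis .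
qed

text \<open>
  Coercivity makes the arguments along a minimizing sequence bounded, so that they converge along
  a subsequence; continuity gives the value of the infimum at their limit, and monotonicity allows
  a feasible point whose arguments do not exceed it.
\<close>

lemma minimum_attained_if_lower_semicontinuous:
  fixes F :: "'p \<Rightarrow> real \<times> real \<times> real"
  assumes ne: "P \<noteq> {}" and F: "\<And>p. p \<in> P \<Longrightarrow> F p \<in> nonneg3"
    and nonneg: "\<forall>t\<in>nonneg3. 0 \<le> f t" and cont: "continuous_on nonneg3 f"
    and inc: "increasing3 f" and coer: "coercive3 f"
    and lsc: "\<And>p r s t. (\<And>n::nat. p n \<in> P) \<Longrightarrow> (\<lambda>n. F (p n)) \<longlonglongrightarrow> (r, s, t) \<Longrightarrow>
      \<exists>q\<in>P. fst (F q) \<le> r \<and> fst (snd (F q)) \<le> s \<and> snd (snd (F q)) \<le> t"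
  shows "\<exists>q\<in>P. \<forall>p\<in>P. f (F q) \<le> f (F p)"
proof -
  define m where "m = (INF p\<in>P. f (F p))"
  have bdd: "bdd_below ((\<lambda>p. f (F p)) ` P)"
    by (rule bdd_belowI2[of _ 0]) (use nonneg F in blast)
  have m_le: "m \<le> f (F p)" if "p \<in> P" for p
    unfolding m_def by (rule cINF_lower[OF bdd that])
  have "\<exists>p\<in>P. f (F p) < m + inverse (Suc n)" for n
    using cINF_less_iff[OF ne bdd, of "m + inverse (Suc n)"] unfolding m_def by simp
  then obtain p where p: "\<And>n. p n \<in> P" "\<And>n. f (F (p n)) < m + inverse (Suc n)" by metis
  have lim_m: "(\<lambda>n. f (F (p n))) \<longlonglongrightarrow> m"
  proof (rule real_tendsto_sandwich)
    show "(\<lambda>n. m) \<longlonglongrightarrow> m" by simp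
    show "(\<lambda>n. m + inverse (Suc n)) \<longlonglongrightarrow> m"
      using tendsto_add[OF tendsto_const LIMSEQ_inverse_real_of_nat] by simp
  qed (use m_le[OF p(1)] p(2) in \<open>auto intro!: always_eventually less_imp_le\<close>)
  have "eventually (\<lambda>t. m + 1 \<le> f t) (inf at_infinity (principal nonneg3))"
    using coer unfolding coercive3_def filterlim_at_top by blast
  then obtain K where K: "\<And>t. norm t \<ge> K \<Longrightarrow> t \<in> nonneg3 \<Longrightarrow> m + 1 \<le> f t"
    unfolding eventually_inf_principal eventually_at_infinity by blast
  have "norm (F (p n)) \<le> K" for n
  proof (rule ccontr)
    assume "\<not> norm (F (p n)) \<le> K"
    then have "m + 1 \<le> f (F (p n))" using K[of "F (p n)"] F[OF p(1)] by simp
    moreover have "inverse (real (Suc n)) \<le> 1" by (simp add: inverse_le_1_iff)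
    ultimately show False using p(2)[of n] by simp
  qed
  then have "bounded (range (\<lambda>n. F (p n)))" by (auto simp: bounded_iff)
  then obtain l k where k: "strict_mono k" and l: "((\<lambda>n. F (p n)) \<circ> k) \<longlonglongrightarrow> l"
    using bounded_imp_convergent_subsequence by blast
  obtain r s t where rst: "l = (r, s, t)" by (cases l)
  have l': "(\<lambda>n. F (p (k n))) \<longlonglongrightarrow> (r, s, t)" using l rst by (simp add: o_def)
  have "closed nonneg3" unfolding nonneg3_def by (intro closed_Times closed_atLeast)
  then have mem: "(r, s, t) \<in> nonneg3"
    by (rule closed_sequentially) (use F p l' in auto)
  have "(\<lambda>n. f (F (p (k n)))) \<longlonglongrightarrow> f (r, s, t)"
    by (rule continuous_on_tendsto_compose[OF cont l' mem]) (use F p in auto)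
  moreover have "(\<lambda>n. f (F (p (k n)))) \<longlonglongrightarrow> m"
    using LIMSEQ_subseq_LIMSEQ[OF lim_m k] by (simp add: o_def)
  ultimately have m_eq: "f (r, s, t) = m" by (rule LIMSEQ_unique)
  obtain q where q: "q \<in> P" "fst (F q) \<le> r" "fst (snd (F q)) \<le> s" "snd (snd (F q)) \<le> t"
    using lsc[of "\<lambda>n. p (k n)", OF p(1) l'] by blast
  obtain r' s' t' where F_q: "F q = (r', s', t')" by (cases "F q")
  have "f (F q) \<le> m"
    unfolding m_eq[symmetric] F_q
    by (rule increasing3_mono[OF inc]) (use F[OF q(1)] F_q q in \<open>auto simp: nonneg3_def\<close>)
  then show ?thesis using q(1) m_le by force
qed

section \<open>Weak compactness in operator ideals\<close>

lemma norming_blinfun_exists: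
  obtains h :: "'a::real_normed_vector \<Rightarrow>\<^sub>L real" where "norm h \<le> 1" "h z = norm z"
proof -
  obtain g where g: "g \<in> dual_on UNIV norm" "\<And>x. \<bar>g x\<bar> \<le> norm x" "g z = norm z"
    using norming_functional_exists[OF normed_space_on_UNIV, of z] by auto
  have "bounded_linear g"
    by (rule bounded_linear_intro[where K = 1])
      (use dual_on_add[OF g(1)] dual_on_scale[OF g(1)] g(2) in auto)
  then have eq: "blinfun_apply (Blinfun g) = g" by (rule bounded_linear_Blinfun_apply)
  have "norm (Blinfun g) \<le> 1" by (rule norm_blinfun_bound) (use g(2) eq in auto)
  then show thesis using that eq g(3) by metis
qed

lemma blinfun_apply_rank_one: "rank_one x' y x = x' x *\<^sub>R y"
  by (simp add: rank_one_def)

lemma norm_rank_one_le: "norm (rank_one x' y) \<le> norm x' * norm y"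
proof (rule norm_blinfun_bound)
  show "norm (rank_one x' y x) \<le> norm x' * norm y * norm x" for x
    using mult_right_mono[OF norm_blinfun[of x' x], of "norm y"]
    by (simp add: blinfun_apply_rank_one algebra_simps)
qed simp

lemma
  assumes "normed_ideal_component I N"
  shows normed_ideal_component_space: "normed_space_on I N"
    and normed_ideal_component_product:
      "X \<in> I \<Longrightarrow> N (S o\<^sub>L X o\<^sub>L R) \<le> norm S * N X * norm R"
    and normed_ideal_component_rank_one: "N (rank_one x' y) = norm x' * norm y"
  using assms by (simp_all add: normed_ideal_component_def)

text \<open>
  With rank one operators \<open>S\<close> and \<open>R\<close> the product \<open>S X R\<close> has rank one, too, and carries the
  scalar \<open>y' (X x)\<close>; the ideal inequality then bounds this scalar by \<open>N X * norm y' * norm x\<close>. The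
  functional \<open>y'\<close> is chosen to norm \<open>X x\<close>.
\<close>

lemma norm_le_ideal_norm:
  assumes I: "normed_ideal_component I N" and X: "X \<in> I"
  shows "norm X \<le> N X"
proof (rule norm_blinfun_bound)
  show "0 \<le> N X" by (rule normed_space_on_nonneg[OF normed_ideal_component_space[OF I] X])
  fix x
  define y where "y = X x"
  show "norm (X x) \<le> N X * norm x"
  proof (cases "y = 0")
    case True
    then show ?thesis using \<open>0 \<le> N X\<close> by (simp add: y_def)
  next
    case False
    then have "x \<noteq> 0" by (auto simp: y_def blinfun.zero_right)
    obtain y' where y': "norm y' \<le> 1" "blinfun_apply y' y = norm y"
      by (rule norming_blinfun_exists)
    obtain x' where x': "norm x' \<le> 1" "blinfun_apply x' x = norm x"
      by (rule norming_blinfun_exists)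
    have "x' \<noteq> 0" using x'(2) \<open>x \<noteq> 0\<close> by auto
    then have pos: "norm x' > 0" "norm y > 0" using False by auto
    have "rank_one y' y o\<^sub>L X o\<^sub>L rank_one x' x = rank_one x' (norm y *\<^sub>R y)"
      by (rule blinfun_eqI)
        (simp add: blinfun_apply_rank_one blinfun.scaleR_right y_def[symmetric] y'(2))
    then have "N (rank_one x' (norm y *\<^sub>R y)) \<le> norm (rank_one y' y) * N X * norm (rank_one x' x)"
      using normed_ideal_component_product[OF I X, of "rank_one y' y" "rank_one x' x"] by simp
    moreover have "N (rank_one x' (norm y *\<^sub>R y)) = norm x' * (norm y * norm y)"
      using normed_ideal_component_rank_one[OF I] by simp
    moreover have "norm (rank_one y' y) * N X * norm (rank_one x' x) \<le> norm y * N X * (norm x' * norm x)"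
    proof (intro mult_mono)
      show "norm (rank_one y' y) \<le> norm y"
        using norm_rank_one_le[of y' y] y'(1) mult_right_mono[OF y'(1), of "norm y"] by simp
    qed (use \<open>0 \<le> N X\<close> norm_rank_one_le in auto)
    ultimately have "(norm x' * norm y) * norm y \<le> (norm x' * norm y) * (N X * norm x)"
      by (simp add: algebra_simps)
    then show ?thesis using pos by (simp add: y_def mult_le_cancel_left_pos)
  qed
qed

lemma ideal_norm_bounded_if_convergent:
  assumes V: "normed_space_on I N" and A: "A \<in> I" and Y: "\<And>n. Y n \<in> I"
    and lim: "(\<lambda>n. N (A - Y n)) \<longlonglongrightarrow> s"
  shows "\<exists>B. \<forall>n. N (Y n) \<le> B"
proof -
  have E: "subspace I" by (rule normed_space_on_subspace[OF V])
  obtain B where B: "\<And>n. norm (N (A - Y n)) \<le> B"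
    using convergent_imp_Bseq[OF convergentI[OF lim]] by (auto simp: Bseq_def)
  have "N (Y n) \<le> N A + B" for n
  proof -
    have "N (A + (Y n - A)) \<le> N A + N (Y n - A)"
      by (rule normed_space_on_triangle[OF V A subspace_diff[OF E Y A]])
    then show ?thesis
      using normed_space_on_minus_commute[OF V A Y] B[of n] by simp
  qed
  then show ?thesis by blast
qed

text \<open>
  A bounded sequence in a reflexive ideal has a weak limit there. Evaluation at a point is bounded
  on the ideal because the ideal norm dominates the operator norm, so the values converge weakly, too.
\<close>

lemma reflexive_ideal_weak_limit:
  assumes L: "generalized_limit L" and I: "normed_ideal_component I N" and R: "reflexive_on I N"
    and A: "A \<in> I" and Y: "\<And>n. Y n \<in> I" and lim: "(\<lambda>n. N (A - Y n)) \<longlonglongrightarrow> s"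
  shows "\<exists>Y0\<in>I. N (A - Y0) \<le> s \<and>
    (\<forall>x. weak_limit L UNIV norm (\<lambda>n. blinfun_apply (Y n) x) (Y0 x))"
proof -
  note V = normed_ideal_component_space[OF I]
  have E: "subspace I" by (rule normed_space_on_subspace[OF V])
  obtain B where B: "\<And>n. N (Y n) \<le> B"
    using ideal_norm_bounded_if_convergent[OF V A Y lim] by blast
  obtain Y0 where Y0: "weak_limit L I N Y Y0"
    by (rule reflexive_imp_weak_limit_exists[OF L V R Y B])
  note mem = weak_limit_mem[OF Y0]
  have neg: "weak_limit L I N (\<lambda>n. - Y n) (- Y0)"
    by (rule weak_limit_image[OF V V Y0, where K = 1])
      (use subspace_neg[OF E] normed_space_on_scale[OF V, of _ "-1"] in auto)
  have "weak_limit L I N (\<lambda>n. A - Y n) (A - Y0)"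
  proof (rule weak_limit_perturb[OF L V neg])
    have "N 0 = 0" using normed_space_on_scale[OF V A, of 0] by simp
    then show "(\<lambda>n. N ((A - Y n - (A - Y0)) - (- Y n - - Y0))) \<longlonglongrightarrow> 0" by simp
  qed (use A Y mem subspace_diff[OF E] in auto)
  then have "N (A - Y0) \<le> s" using lim by (rule weak_limit_norm_le_limit[OF L V])
  moreover have "weak_limit L UNIV norm (\<lambda>n. blinfun_apply (Y n) x) (Y0 x)" for x
  proof (rule weak_limit_image[OF V normed_space_on_UNIV Y0, where K = "norm x"])
    fix X assume X: "X \<in> I"
    have "norm (blinfun_apply X x) \<le> norm X * norm x" by (rule norm_blinfun)
    also have "\<dots> \<le> N X * norm x"
      by (intro mult_right_mono norm_le_ideal_norm[OF I X]) simp
    finally show "norm (blinfun_apply X x) \<le> norm x * N X" by (simp add: mult.commute)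
  qed (auto simp: blinfun.add_left blinfun.scaleR_left)
  ultimately show ?thesis using mem by blast
qed

text \<open>
  The space of operators need not be reflexive here, but a bounded sequence of operators has weak
  limits pointwise. They depend linearly on the point because all of them are taken along the
  same generalized limit.
\<close>

lemma reflexive_target_weak_limit:
  fixes A :: "'a::real_normed_vector \<Rightarrow>\<^sub>L 'b::real_normed_vector"
  assumes L: "generalized_limit L" and R: "reflexive_on (UNIV :: 'b set) norm"
    and lim: "(\<lambda>n. norm (A - Y n)) \<longlonglongrightarrow> s"
  shows "\<exists>Y0. norm (A - Y0) \<le> s \<and>
    (\<forall>x. weak_limit L UNIV norm (\<lambda>n. blinfun_apply (Y n) x) (Y0 x))"
proof -
  note U = normed_space_on_UNIV
  have "\<exists>B. \<forall>n. norm (Y n) \<le> B"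
    by (rule ideal_norm_bounded_if_convergent[OF U _ _ lim]) simp_all
  then obtain B where B: "\<And>n. norm (Y n) \<le> B" by blast
  have B_apply: "norm (Y n x) \<le> B * norm x" for n x
    using order_trans[OF norm_blinfun mult_right_mono[OF B norm_ge_zero]] .
  have "\<exists>y. weak_limit L UNIV norm (\<lambda>n. blinfun_apply (Y n) x) y" for x
    by (rule reflexive_imp_weak_limit_exists[OF L U R UNIV_I B_apply]) (rule exI)
  then obtain F where F: "\<And>x. weak_limit L UNIV norm (\<lambda>n. blinfun_apply (Y n) x) (F x)" by metis
  have "bounded_linear F"
  proof (rule bounded_linear_intro[where K = B])
    fix x y
    have "weak_limit L UNIV norm (\<lambda>n. blinfun_apply (Y n) (x + y)) (F x + F y)"
      using weak_limit_add[OF L U F[of x] F[of y]] by (simp add: blinfun.add_right)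
    with F show "F (x + y) = F x + F y" by (rule weak_limit_unique[OF U])
  next
    fix a x
    have "weak_limit L UNIV norm (\<lambda>n. a *\<^sub>R blinfun_apply (Y n) x) (a *\<^sub>R F x)"
      by (rule weak_limit_image[OF U U F, where K = "\<bar>a\<bar>"]) (auto simp: scaleR_add_right)
    then have "weak_limit L UNIV norm (\<lambda>n. blinfun_apply (Y n) (a *\<^sub>R x)) (a *\<^sub>R F x)"
      by (simp add: blinfun.scaleR_right)
    with F show "F (a *\<^sub>R x) = a *\<^sub>R F x" by (rule weak_limit_unique[OF U])
  next
    fix x
    show "norm (F x) \<le> norm x * B"
      using B_apply[of _ x] by (intro weak_limit_norm_le[OF L U F]) (simp add: mult.commute)
  qed
  define Y0 where "Y0 = Blinfun F"
  have Y0: "blinfun_apply Y0 = F"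
    unfolding Y0_def by (rule bounded_linear_Blinfun_apply) fact
  have "s \<ge> 0" using lim by (rule LIMSEQ_le_const) simp
  have "norm (A - Y0) \<le> s"
  proof (rule norm_blinfun_bound[OF \<open>s \<ge> 0\<close>])
    fix x
    have neg: "weak_limit L UNIV norm (\<lambda>n. - blinfun_apply (Y n) x) (- F x)"
      by (rule weak_limit_image[OF U U F, where K = 1]) auto
    have diff: "weak_limit L UNIV norm (\<lambda>n. (A - Y n) x) ((A - Y0) x)"
      by (rule weak_limit_perturb[OF L U neg]) (auto simp: Y0 blinfun.diff_left)
    show "norm ((A - Y0) x) \<le> s * norm x"
    proof (rule field_le_epsilon)
      fix e :: real assume e: "e > 0"
      have "(\<lambda>n. norm (A - Y n) * norm x) \<longlonglongrightarrow> s * norm x" using lim by (intro tendsto_intros)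
      then have "eventually (\<lambda>n. norm (A - Y n) * norm x < s * norm x + e) sequentially"
        by (rule order_tendstoD) (use e in simp)
      then have "eventually (\<lambda>n. norm ((A - Y n) x) \<le> s * norm x + e) sequentially"
        by (rule eventually_mono) (rule order_trans[OF norm_blinfun less_imp_le])
      then show "norm ((A - Y0) x) \<le> s * norm x + e"
        by (rule weak_limit_norm_le[OF L U diff])
    qed
  qed
  then show ?thesis using F Y0 by auto
qed

section \<open>Lower semicontinuity along minimizing sequences\<close>

text \<open>
  If one of the factors \<open>X\<^sub>n\<close>, \<open>x\<^sub>n\<close> converges in norm and the other one weakly, then \<open>X\<^sub>n x\<^sub>n\<close> converges
  weakly. Here the points converge in norm, along a subsequence, and \<open>X\<^sub>n x\<^sub>n - X\<^sub>n y\<close> tends to 0 as the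
  operators are bounded. The hypothesis \<open>weak\<close> is what a reflexive ideal and a reflexive target have
  in common.
\<close>

lemma compact_domain_lower_semicontinuous:
  fixes T :: "'a::banach \<Rightarrow>\<^sub>L 'c::real_normed_vector" and A :: "'a \<Rightarrow>\<^sub>L 'b::banach"
  assumes L: "generalized_limit L" and I: "normed_ideal_component I N" and A: "A \<in> I"
    and D: "compact D"
    and weak: "\<And>Y s. (\<And>n. Y n \<in> I) \<Longrightarrow> (\<lambda>n. N (A - Y n)) \<longlonglongrightarrow> s \<Longrightarrow>
      \<exists>Y0\<in>I. N (A - Y0) \<le> s \<and>
        (\<forall>x. weak_limit L UNIV norm (\<lambda>n. blinfun_apply (Y n) x) (Y0 x))"
    and X: "\<And>n. X n \<in> I" and x: "\<And>n. x n \<in> D"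
    and r: "(\<lambda>n. norm (T (x n))) \<longlonglongrightarrow> r" and s: "(\<lambda>n. N (A - X n)) \<longlonglongrightarrow> s"
    and t: "(\<lambda>n. norm (X n (x n) - b)) \<longlonglongrightarrow> t"
  shows "\<exists>Y\<in>I. \<exists>y\<in>D. norm (T y) \<le> r \<and> N (A - Y) \<le> s \<and> norm (Y y - b) \<le> t"
proof -
  note V = normed_ideal_component_space[OF I] and U = normed_space_on_UNIV
  obtain y k where y: "y \<in> D" and k: "strict_mono k" and lim: "(x \<circ> k) \<longlonglongrightarrow> y"
    using D x unfolding compact_def by metis
  have "(\<lambda>n. norm (T (x (k n)))) \<longlonglongrightarrow> norm (T y)"
    using lim by (intro tendsto_intros) (simp add: o_def)
  moreover have "(\<lambda>n. norm (T (x (k n)))) \<longlonglongrightarrow> r"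
    using LIMSEQ_subseq_LIMSEQ[OF r k] by (simp add: o_def)
  ultimately have r_eq: "norm (T y) = r" by (rule LIMSEQ_unique)
  have s': "(\<lambda>n. N (A - X (k n))) \<longlonglongrightarrow> s" and t': "(\<lambda>n. norm (X (k n) (x (k n)) - b)) \<longlonglongrightarrow> t"
    using LIMSEQ_subseq_LIMSEQ[OF s k] LIMSEQ_subseq_LIMSEQ[OF t k] by (simp_all add: o_def)
  obtain Y where Y: "Y \<in> I" "N (A - Y) \<le> s"
    and wl: "\<And>z. weak_limit L UNIV norm (\<lambda>n. blinfun_apply (X (k n)) z) (Y z)"
    using weak[of "\<lambda>n. X (k n)", OF X s'] by blast
  obtain B where B: "\<And>n. N (X (k n)) \<le> B"
    using ideal_norm_bounded_if_convergent[OF V A X s'] by blast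
  have "weak_limit L UNIV norm (\<lambda>n. X (k n) (x (k n)) - b) (Y y - b)"
  proof (rule weak_limit_perturb[OF L U wl[of y]])
    have null: "(\<lambda>n. B * norm (x (k n) - y)) \<longlonglongrightarrow> 0"
      using lim by (intro tendsto_mult_right_zero tendsto_norm_zero LIM_zero) (simp add: o_def)
    show "(\<lambda>n. norm ((X (k n) (x (k n)) - b - (Y y - b)) - (X (k n) y - Y y))) \<longlonglongrightarrow> 0"
    proof (rule Lim_null_comparison[OF _ null], rule always_eventually, rule allI)
      fix n
      have "norm (X (k n) (x (k n) - y)) \<le> norm (X (k n)) * norm (x (k n) - y)"
        by (rule norm_blinfun)
      also have "\<dots> \<le> B * norm (x (k n) - y)"
        using order_trans[OF norm_le_ideal_norm[OF I X] B] by (intro mult_right_mono) auto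
      finally show "norm (norm ((X (k n) (x (k n)) - b - (Y y - b)) - (X (k n) y - Y y)))
          \<le> B * norm (x (k n) - y)"
        by (simp add: blinfun.diff_right algebra_simps)
    qed
  qed auto
  then have "norm (Y y - b) \<le> t" using t' by (rule weak_limit_norm_le_limit[OF L U])
  then show ?thesis using Y y r_eq by blast
qed

lemma Metric_space_norm_dist:
  assumes V: "normed_space_on V N"
  shows "Metric_space V (norm_dist V N)"
proof
  have E: "subspace V" by (rule normed_space_on_subspace[OF V])
  show "0 \<le> norm_dist V N x y" for x y
    using normed_space_on_nonneg[OF V] subspace_diff[OF E] by (simp add: norm_dist_def)
  show "norm_dist V N x y = norm_dist V N y x" for x y
    using normed_space_on_minus_commute[OF V] by (simp add: norm_dist_def)
  show "norm_dist V N x y = 0 \<longleftrightarrow> x = y" if "x \<in> V" "y \<in> V" for x y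
    using that normed_space_on_eq_0[OF V subspace_diff[OF E that]] normed_space_on_scale[OF V that(1), of 0]
    by (auto simp: norm_dist_def)
  show "norm_dist V N x z \<le> norm_dist V N x y + norm_dist V N y z"
    if "x \<in> V" "y \<in> V" "z \<in> V" for x y z
    using that normed_space_on_triangle[OF V, of "x - y" "y - z"] subspace_diff[OF E]
    by (simp add: norm_dist_def)
qed

lemma compactin_norm_topology_subsequence:
  assumes V: "normed_space_on V N" and C: "compactin (norm_topology V N) C" and X: "\<And>n::nat. X n \<in> C"
  obtains Y k where "C \<subseteq> V" "Y \<in> C" "strict_mono k" "(\<lambda>n. N (X (k n) - Y)) \<longlonglongrightarrow> 0"
proof -
  interpret Metric_space V "norm_dist V N" by (rule Metric_space_norm_dist[OF V])
  have sub: "C \<subseteq> V" and "\<exists>l r. l \<in> C \<and> strict_mono r \<and> limitin mtopology (X \<circ> r) l sequentially"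
    using C X unfolding norm_topology_def compactin_sequentially by (auto simp: image_subset_iff)
  then obtain Y k where Y: "Y \<in> C" and k: "strict_mono k" and
    lim: "limitin mtopology (X \<circ> k) Y sequentially" by blast
  have "(\<lambda>n. norm_dist V N (X (k n)) Y) \<longlonglongrightarrow> 0"
    using lim unfolding limitin_metric_dist_null by (simp add: o_def)
  moreover have "norm_dist V N (X (k n)) Y = N (X (k n) - Y)" for n
    using X Y sub by (auto simp: norm_dist_def)
  ultimately show thesis using that sub Y k by simp
qed

text \<open>
  Here the operators converge in norm along a subsequence, and the points converge weakly in the
  reflexive domain; the points are bounded because \<open>T\<close> is bounded below.
\<close>

lemma compact_operators_lower_semicontinuous:
  fixes T :: "'a::banach \<Rightarrow>\<^sub>L 'c::real_normed_vector" and A :: "'a \<Rightarrow>\<^sub>L 'b::banach"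
  assumes L: "generalized_limit L" and I: "normed_ideal_component I N" and A: "A \<in> C"
    and C: "compactin (norm_topology I N) C" and R: "reflexive_on (UNIV :: 'a set) norm"
    and T: "bounded_below T" and X: "\<And>n. X n \<in> C"
    and r: "(\<lambda>n. norm (T (x n))) \<longlonglongrightarrow> r" and s: "(\<lambda>n. N (A - X n)) \<longlonglongrightarrow> s"
    and t: "(\<lambda>n. norm (X n (x n) - b)) \<longlonglongrightarrow> t"
  shows "\<exists>Y\<in>C. \<exists>y. norm (T y) \<le> r \<and> N (A - Y) \<le> s \<and> norm (Y y - b) \<le> t"
proof -
  note V = normed_ideal_component_space[OF I] and U = normed_space_on_UNIV
  have E: "subspace I" by (rule normed_space_on_subspace[OF V])
  obtain Y k where sub: "C \<subseteq> I" and Y: "Y \<in> C" and k: "strict_mono k"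
    and null: "(\<lambda>n. N (X (k n) - Y)) \<longlonglongrightarrow> 0"
    by (rule compactin_norm_topology_subsequence[where X = X, OF V C X])
  have mem: "A \<in> I" "Y \<in> I" "X n \<in> I" for n using sub A Y X by auto
  have r': "(\<lambda>n. norm (T (x (k n)))) \<longlonglongrightarrow> r" and s': "(\<lambda>n. N (A - X (k n))) \<longlonglongrightarrow> s"
    and t': "(\<lambda>n. norm (X (k n) (x (k n)) - b)) \<longlonglongrightarrow> t"
    using LIMSEQ_subseq_LIMSEQ[OF r k] LIMSEQ_subseq_LIMSEQ[OF s k] LIMSEQ_subseq_LIMSEQ[OF t k]
    by (simp_all add: o_def)
  have "N (A - Y) \<le> s"
  proof (rule LIMSEQ_le_const)
    show "(\<lambda>n. N (A - X (k n)) + N (X (k n) - Y)) \<longlonglongrightarrow> s"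
      using tendsto_add[OF s' null] by simp
    have "N (A - Y) \<le> N (A - X (k n)) + N (X (k n) - Y)" for n
      using normed_space_on_triangle[OF V, of "A - X (k n)" "X (k n) - Y"] subspace_diff[OF E] mem by simp
    then show "\<exists>M. \<forall>n\<ge>M. N (A - Y) \<le> N (A - X (k n)) + N (X (k n) - Y)" by blast
  qed
  obtain c where c: "c > 0" "\<And>z. norm (T z) \<ge> c * norm z"
    using T unfolding bounded_below_def by blast
  obtain K where K: "\<And>n. norm (norm (T (x (k n)))) \<le> K"
    using convergent_imp_Bseq[OF convergentI[OF r']] by (auto simp: Bseq_def)
  have B: "norm (x (k n)) \<le> K / c" for n
    using c(1) K[of n] c(2)[of "x (k n)"] by (simp add: field_simps)
  obtain y where y: "weak_limit L UNIV norm (\<lambda>n. x (k n)) y"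
    by (rule reflexive_imp_weak_limit_exists[OF L U R UNIV_I B])
  have "norm (T y) \<le> r"
    using weak_limit_blinfun_apply[OF y] r' by (rule weak_limit_norm_le_limit[OF L U])
  have "weak_limit L UNIV norm (\<lambda>n. X (k n) (x (k n)) - b) (Y y - b)"
  proof (rule weak_limit_perturb[OF L U weak_limit_blinfun_apply[OF y, of Y]])
    have null': "(\<lambda>n. N (X (k n) - Y) * (K / c)) \<longlonglongrightarrow> 0"
      using null by (rule tendsto_mult_left_zero)
    show "(\<lambda>n. norm ((X (k n) (x (k n)) - b - (Y y - b)) - (Y (x (k n)) - Y y))) \<longlonglongrightarrow> 0"
    proof (rule Lim_null_comparison[OF _ null'], rule always_eventually, rule allI)
      fix n
      have XY: "X (k n) - Y \<in> I" using mem subspace_diff[OF E] by blast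
      have "norm ((X (k n) - Y) (x (k n))) \<le> norm (X (k n) - Y) * norm (x (k n))"
        by (rule norm_blinfun)
      also have "\<dots> \<le> N (X (k n) - Y) * (K / c)"
        by (intro mult_mono norm_le_ideal_norm[OF I XY] B normed_space_on_nonneg[OF V XY] norm_ge_zero)
      finally show "norm (norm ((X (k n) (x (k n)) - b - (Y y - b)) - (Y (x (k n)) - Y y)))
          \<le> N (X (k n) - Y) * (K / c)"
        by (simp add: blinfun.diff_left algebra_simps)
    qed
  qed auto
  then have "norm (Y y - b) \<le> t" using t' by (rule weak_limit_norm_le_limit[OF L U])
  then show ?thesis using Y \<open>N (A - Y) \<le> s\<close> \<open>norm (T y) \<le> r\<close> by blast
qed

theorem proposition5p1:
  fixes I :: "('a::banach \<Rightarrow>\<^sub>L 'b::banach) set"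
    and N :: "('a \<Rightarrow>\<^sub>L 'b) \<Rightarrow> real"
    and C :: "('a \<Rightarrow>\<^sub>L 'b) set"
    and D :: "'a set"
    and A :: "'a \<Rightarrow>\<^sub>L 'b"
    and T :: "'a \<Rightarrow>\<^sub>L 'c::banach"
    and b :: 'b
    and f :: "real \<times> real \<times> real \<Rightarrow> real"
  assumes "infinite_dimensional TYPE('a)"
    and "infinite_dimensional TYPE('b)"
    and "infinite_dimensional TYPE('c)"
    and "normed_ideal_component I N"
    and "C \<noteq> {}" and "convex C" and "closedin (norm_topology I N) C"
    and "D \<noteq> {}" and "convex D" and "closed D"
    and "A \<in> C"
    and "\<forall>t\<in>nonneg3. 0 \<le> f t"
    and "continuous_on nonneg3 f"
    and "increasing3 f"
    and "coercive3 f"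
    and "bounded_below T"
    and "(compactin (norm_topology I N) C \<and> D = UNIV \<and> reflexive_space TYPE('a)) \<or>
         (C = I \<and> banach_space_on I N \<and> reflexive_on I N \<and> compact D) \<or>
         (C = I \<and> I = UNIV \<and> N = norm \<and> reflexive_space TYPE('b) \<and> compact D)"
  shows "\<exists>X\<in>C. \<exists>x\<in>D. \<forall>Y\<in>C. \<forall>y\<in>D.
           f (norm (T x), N (A - X), norm (X x - b)) \<le> f (norm (T y), N (A - Y), norm (Y y - b))"
proof -
  obtain L where L: "generalized_limit L" using generalized_limit_exists by blast
  note I = assms(4)
  note V = normed_ideal_component_space[OF I]
  define F where "F = (\<lambda>(X :: 'a \<Rightarrow>\<^sub>L 'b, x :: 'a). (norm (T x), N (A - X), norm (X x - b)))"
  have CI: "C \<subseteq> I"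
  proof -
    interpret Metric_space I "norm_dist I N" by (rule Metric_space_norm_dist[OF V])
    show ?thesis using closedin_subset[OF assms(7)] by (simp add: norm_topology_def)
  qed
  have "\<exists>q\<in>C \<times> D. \<forall>p\<in>C \<times> D. f (F q) \<le> f (F p)"
  proof (rule minimum_attained_if_lower_semicontinuous[OF _ _ assms(12-15)])
    show "C \<times> D \<noteq> {}" using assms(5,8) by auto
    show "F p \<in> nonneg3" if "p \<in> C \<times> D" for p
    proof -
      obtain X x where p: "p = (X, x)" by (cases p)
      have "A - X \<in> I"
        using that p CI assms(11) by (intro subspace_diff[OF normed_space_on_subspace[OF V]]) auto
      then show ?thesis
        using normed_space_on_nonneg[OF V] by (simp add: p F_def nonneg3_def)
    qed
  next
    fix p :: "nat \<Rightarrow> ('a \<Rightarrow>\<^sub>L 'b) \<times> 'a" and r s t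
    assume p: "\<And>n. p n \<in> C \<times> D" and lim: "(\<lambda>n. F (p n)) \<longlonglongrightarrow> (r, s, t)"
    define X x where "X n = fst (p n)" and "x n = snd (p n)" for n
    have X: "\<And>n. X n \<in> C" and x: "\<And>n. x n \<in> D" using p by (auto simp: X_def x_def mem_Times_iff)
    have r: "(\<lambda>n. norm (T (x n))) \<longlonglongrightarrow> r"
      using tendsto_fst[OF lim] by (simp add: F_def X_def x_def case_prod_beta)
    have s: "(\<lambda>n. N (A - X n)) \<longlonglongrightarrow> s"
      using tendsto_fst[OF tendsto_snd[OF lim]] by (simp add: F_def X_def x_def case_prod_beta)
    have t: "(\<lambda>n. norm (X n (x n) - b)) \<longlonglongrightarrow> t"
      using tendsto_snd[OF tendsto_snd[OF lim]] by (simp add: F_def X_def x_def case_prod_beta)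
    have "\<exists>Y\<in>C. \<exists>y\<in>D. norm (T y) \<le> r \<and> N (A - Y) \<le> s \<and> norm (Y y - b) \<le> t"
      using assms(17)
    proof (elim disjE conjE)
      assume C: "compactin (norm_topology I N) C" and D: "D = UNIV" and R: "reflexive_space TYPE('a)"
      show ?thesis
        using compact_operators_lower_semicontinuous[where X = X and x = x,
            OF L I assms(11) C R[unfolded reflexive_space_def] assms(16) X r s t] D by simp
    next
      assume C: "C = I" and R: "reflexive_on I N" and D: "compact D"
      show ?thesis
        unfolding C
        by (rule compact_domain_lower_semicontinuous[where X = X and x = x, OF L I _ D _ _ x r s t])
          (use reflexive_ideal_weak_limit[OF L I R] assms(11) X C in blast)+
    next
      assume C: "C = I" and I_eq: "I = UNIV" "N = norm" and R: "reflexive_space TYPE('b)" and D: "compact D"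
      show ?thesis
        unfolding C
      proof (rule compact_domain_lower_semicontinuous[where X = X and x = x, OF L I _ D _ _ x r s t])
        fix Y s assume "(\<lambda>n. N (A - Y n)) \<longlonglongrightarrow> s"
        then show "\<exists>Y0\<in>I. N (A - Y0) \<le> s \<and>
            (\<forall>x. weak_limit L UNIV norm (\<lambda>n. blinfun_apply (Y n) x) (Y0 x))"
          using reflexive_target_weak_limit[OF L R[unfolded reflexive_space_def], of A Y s]
          by (simp add: I_eq)
      qed (simp_all add: I_eq)
    qed
    then show "\<exists>q\<in>C \<times> D. fst (F q) \<le> r \<and> fst (snd (F q)) \<le> s \<and> snd (snd (F q)) \<le> t"
      by (force simp: F_def)
  qed
  then show ?thesis by (force simp: F_def)
qed

end
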